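(* Let $\mu_\infty$ be the uniform probability measure on $[-1,1]$. There exists $w_*\in(0,1)$ such that if $w_*\le|w|<1$, then $\nu_{\infty,w}\ne\mu_2$, where $\nu_{\infty,w}$ denotes the unique minimizer of $$\nu\mapsto\mathbb{I}^{\mathsf{qu}}_{\infty,\nu}(w)+H(\nu|\mu_2)+\tfrac12\bigl(1-m_2(\nu)\bigr)$$ over $\{\nu\in\mathcal{P}(\mathbb{R}):m_2(\nu)\le1\}$; that is, for such $w$ the minimizer is not the standard Gaussian measure $\mu_2$. Consequently, for such $w$ the strict inequality $\mathbb{I}^{\mathsf{an}}_\infty(w)<\mathbb{I}^{\mathsf{qu}}_{\infty,\mu_2}(w)$ holds.
   Context: $\mathcal{P}(\mathbb{R})$ is the set of Borel probability measures on $\mathbb{R}$; $m_2(\nu)=\int x^2\nu(dx)$; $H(\nu|\mu)=\int\log\frac{d\nu}{d\mu}d\nu$ if $\nu\ll\mu$ and $+\infty$ otherwise. Legendre transform: $\Lambda^*(\tau)=\sup_t\{\langle t,\tau\rangle-\Lambda(t)\}$. Define $$\mathrm{M}_\infty(t)=\int e^{ty}\mu_\infty(dy),\quad\Psi_{\infty,\nu}(t)=\int_{\mathbb{R}}\log\mathrm{M}_\infty(tu)\,\nu(du),\quad\mathbb{I}^{\mathsf{qu}}_{\infty,\nu}(w)=\Psi^*_{\infty,\nu}(w),$$ $$\Phi_\infty(t_0,t_1)=\log\int\int e^{t_0z^2+t_1zx}\mu_2(dz)\mu_\infty(dx),\quad\mathbb{I}^{\mathsf{an}}_\infty(w)=\inf\{\Phi^*_\infty(\tau_0,\tau_1):\tau_0>0,\tau_1\in\mathbb{R},\tau_0^{-1/2}\tau_1=w\}.$$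 The infimum over $\{m_2(\nu)\le 1\}$ of the displayed functional in the claim equals $\mathbb{I}^{\mathsf{an}}_\infty(w)$ for every $w\in\mathbb{R}$, and when $\mathbb{I}^{\mathsf{an}}_\infty(w)<\infty$ it is attained at a unique minimizer, denoted $\nu_{\infty,w}$. *)

theory Defs
  imports "HOL-Probability.Probability"
begin

text \<open>
  Lebesgue integral of a real function with values in the extended reals: positive part minus
  negative part.  It is used only where the negative part has finite integral, so the case
  \<open>\<infinity> - \<infinity>\<close> never matters.  (The Bochner integral would give \<open>0\<close> instead of \<open>\<infinity>\<close> on functions
  that are not integrable.)
\<close>
definition ext_integral :: "'a measure \<Rightarrow> ('a \<Rightarrow> real) \<Rightarrow> ereal" where
  "ext_integral M f =
     enn2ereal (\<integral>\<^sup>+ x. ennreal (f x) \<partial>M) - enn2ereal (\<integral>\<^sup>+ x. ennreal (- f x) \<partial>M)"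

definition legendre :: "('a::real_inner \<Rightarrow> ereal) \<Rightarrow> 'a \<Rightarrow> ereal" where
  "legendre \<Lambda> \<tau> = (SUP t. ereal (t \<bullet> \<tau>) - \<Lambda> t)"

text \<open>Natural logarithm on \<open>[0, \<infinity>]\<close>, with \<open>log 0 = -\<infinity>\<close> and \<open>log \<infinity> = \<infinity>\<close>.\<close>
definition ln_ennreal :: "ennreal \<Rightarrow> ereal" where
  "ln_ennreal x = (if x = 0 then - \<infinity> else if x = \<infinity> then \<infinity> else ereal (ln (enn2real x)))"

definition second_moment :: "real measure \<Rightarrow> ennreal" where
  "second_moment \<nu> = (\<integral>\<^sup>+ x. ennreal (x\<^sup>2) \<partial>\<nu>)"

text \<open>
  Relative entropy \<open>H(\<nu>|\<mu>)\<close>.  \<^const>\<open>entropy_density\<close> with base \<open>exp 1\<close> is \<open>ln (d\<nu>/d\<mu>)\<close>;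
  \<^const>\<open>KL_divergence\<close> is not used because it is \<open>0\<close> when this function is not \<open>\<nu>\<close>-integrable.
\<close>
definition rel_entropy :: "'a measure \<Rightarrow> 'a measure \<Rightarrow> ereal" where
  "rel_entropy \<nu> \<mu> =
     (if absolutely_continuous \<mu> \<nu> then ext_integral \<nu> (entropy_density (exp 1) \<mu> \<nu>) else \<infinity>)"

definition mu_inf :: "real measure" where
  "mu_inf = uniform_measure lborel {-1..1}"

definition M_inf :: "real \<Rightarrow> real" where
  "M_inf t = (\<integral>y. exp (t * y) \<partial>mu_inf)"

definition Psi_inf :: "real measure \<Rightarrow> real \<Rightarrow> ereal" where
  "Psi_inf \<nu> t = ext_integral \<nu> (\<lambda>u. ln (M_inf (t * u)))"

definition I_qu :: "real measure \<Rightarrow> real \<Rightarrow> ereal" where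
  "I_qu \<nu> w = legendre (Psi_inf \<nu>) w"

text \<open>The measure called \<open>\<mu>\<^sub>2\<close> in the mathematics is \<^const>\<open>std_normal_distribution\<close>.\<close>
definition Phi_inf :: "real \<times> real \<Rightarrow> ereal" where
  "Phi_inf = (\<lambda>(t0, t1). ln_ennreal
     (\<integral>\<^sup>+ x. \<integral>\<^sup>+ z. ennreal (exp (t0 * z\<^sup>2 + t1 * z * x)) \<partial>std_normal_distribution \<partial>mu_inf))"

definition I_an :: "real \<Rightarrow> ereal" where
  "I_an w = Inf {legendre Phi_inf (\<tau>0, \<tau>1) |\<tau>0 \<tau>1. \<tau>0 > 0 \<and> \<tau>0 powr (-1/2) * \<tau>1 = w}"

text \<open>
  The locale predicate \<^locale>\<open>real_distribution\<close> describes the Borel probability measures on the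
  real line.
\<close>
definition admissible :: "real measure \<Rightarrow> bool" where
  "admissible \<nu> \<longleftrightarrow> real_distribution \<nu> \<and> second_moment \<nu> \<le> 1"

definition rate_functional :: "real \<Rightarrow> real measure \<Rightarrow> ereal" where
  "rate_functional w \<nu> = I_qu \<nu> w + rel_entropy \<nu> std_normal_distribution
     + ereal (1/2) * (1 - enn2ereal (second_moment \<nu>))"

definition is_minimizer :: "real \<Rightarrow> real measure \<Rightarrow> bool" where
  "is_minimizer w \<nu> \<longleftrightarrow> is_arg_min (rate_functional w) admissible \<nu>"

definition nu_inf :: "real \<Rightarrow> real measure" where
  "nu_inf w = (THE \<nu>. is_minimizer w \<nu>)"

end

theory Submission
  imports Defs
begin

text \<open>
  The minimizer is explicit.  Bound \<open>I_qu \<nu> w\<close> from below by one affine function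
  \<open>t w - \<integral> ln M_inf (t u) \<nu>(du)\<close> and spend the constraint \<open>m\<^sub>2(\<nu>) \<le> 1\<close> with a multiplier: the
  functional is then at least a constant plus the relative entropy of \<open>\<nu>\<close> with respect to the measure with
  Gaussian density proportional to \<open>exp (- \<beta> u\<^sup>2) M_inf (t u)\<close>.  If \<open>\<beta>\<close> and \<open>t\<close> are such that this
  measure has second moment \<open>1\<close> and the supremum defining its \<open>I_qu\<close> is attained at \<open>t\<close>, it is the unique
  minimizer.  Writing \<open>exp (t u x)\<close> as a Gaussian mean shift turns these two equations into one
  equation for the mean \<open>q c\<close> of \<open>x\<^sup>2\<close> under the tilt of \<open>mu_inf\<close> by \<open>exp (c x\<^sup>2)\<close>, namely
  \<open>2 c q (q - w\<^sup>2) = w\<^sup>2\<close>, which the intermediate value theorem solves because \<open>q c\<close> tends to \<open>1\<close>.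
  The same tilt shows that \<open>I_an w\<close> is finite.  On the other hand \<open>ln M_inf t \<le> \<bar>t\<bar>\<close>, so the
  quenched rate of the Gaussian is infinite as soon as \<open>\<bar>w\<bar>\<close> exceeds its first absolute moment
  \<open>sqrt (2 / pi) < 9 / 10\<close>.
\<close>

section \<open>The uniform measure and its exponential tilts\<close>

lemma prob_space_mu_inf: "prob_space mu_inf"
  unfolding mu_inf_def by (rule prob_space_uniform_measure) auto

lemma sets_mu_inf [simp, measurable_cong]: "sets mu_inf = sets borel"
  by (simp add: mu_inf_def)

lemma space_mu_inf [simp]: "space mu_inf = UNIV"
  by (simp add: mu_inf_def)

interpretation mu_inf: prob_space mu_inf
  by (rule prob_space_mu_inf)

lemma prob_mu_inf_UNIV [simp]: "measure mu_inf UNIV = 1"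
  using mu_inf.prob_space by simp

lemma AE_mu_inf: "AE x in mu_inf. \<bar>x\<bar> \<le> 1"
  unfolding mu_inf_def by (rule AE_uniform_measureI) auto

lemma integrable_mu_inf:
  fixes f :: "real \<Rightarrow> real"
  assumes f: "f \<in> borel_measurable borel" and bound: "\<And>x. \<bar>x\<bar> \<le> 1 \<Longrightarrow> \<bar>f x\<bar> \<le> B"
  shows "integrable mu_inf f"
proof (rule mu_inf.integrable_const_bound)
  show "AE x in mu_inf. norm (f x) \<le> B"
    using AE_mu_inf by eventually_elim (use bound in auto)
  show "f \<in> borel_measurable mu_inf"
    using f by (simp cong: measurable_cong_sets)
qed

lemma integrable_mu_inf_continuous:
  fixes f :: "real \<Rightarrow> real"
  assumes "continuous_on UNIV f"
  shows "integrable mu_inf f"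
proof -
  have "compact (f ` {-1..1})"
    by (rule compact_continuous_image) (use assms continuous_on_subset in auto)
  then obtain B where "\<And>x. x \<in> f ` {-1..1} \<Longrightarrow> norm x \<le> B"
    using compact_imp_bounded bounded_iff by metis
  then show ?thesis
    by (intro integrable_mu_inf[where B = B] borel_measurable_continuous_onI assms)
       (force simp: abs_le_iff)
qed

lemma integral_mu_inf_pos:
  fixes f :: "real \<Rightarrow> real"
  assumes f: "integrable mu_inf f" and nn: "\<And>x. 0 \<le> f x"
    and pos: "\<And>x. r < x \<Longrightarrow> x < 1 \<Longrightarrow> 0 < f x" and r: "r < 1"
  shows "0 < (\<integral>x. f x \<partial>mu_inf)"
proof (rule ccontr)
  assume "\<not> 0 < (\<integral>x. f x \<partial>mu_inf)"
  moreover have "0 \<le> (\<integral>x. f x \<partial>mu_inf)"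
    using nn by (intro integral_nonneg_AE) auto
  ultimately have "(\<integral>x. f x \<partial>mu_inf) = 0"
    by linarith
  then have "AE x in mu_inf. f x = 0"
    using integral_nonneg_eq_0_iff_AE[OF f] nn by simp
  \<comment> \<open>\<open>max r 0\<close> keeps the interval inside the support, where it has
    positive mass.\<close>
  then have ae: "AE x in mu_inf. x \<notin> {max r 0<..<1}"
    by eventually_elim (use pos in fastforce)
  have "{max r 0<..<1} \<in> null_sets mu_inf"
    using AE_iff_null_sets[of "{max r 0<..<1}" mu_inf] ae by auto
  then have "emeasure mu_inf {max r 0<..<1} = 0"
    by auto
  moreover have "{-1..1} \<inter> {max r 0<..<1} = {max r 0<..<1::real}"
    by auto
  ultimately have "emeasure lborel {max r 0<..<1} / emeasure lborel {-1..1::real} = 0"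
    unfolding mu_inf_def by (subst (asm) emeasure_uniform_measure) auto
  then show False
    using r by (auto simp: ennreal_divide_eq_0_iff ennreal_eq_0_iff)
qed

lemma integrable_exp_mu_inf [simp]: "integrable mu_inf (\<lambda>x. exp (t * x))"
  by (intro integrable_mu_inf_continuous continuous_intros)

lemma integrable_id_exp_mu_inf [simp]: "integrable mu_inf (\<lambda>x. x * exp (t * x))"
  by (intro integrable_mu_inf_continuous continuous_intros)

section \<open>The logarithmic moment generating function\<close>

lemma M_inf_pos: "0 < M_inf t"
  unfolding M_inf_def by (rule integral_mu_inf_pos[where r = 0]) auto

text \<open>The support lies in \<open>[-1, 1]\<close>. The linear growth gives integrability under
  every law with a first moment.\<close>

lemma abs_ln_M_inf_le: "\<bar>ln (M_inf t)\<bar> \<le> \<bar>t\<bar>"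
proof -
  have *: "\<bar>t * x\<bar> \<le> \<bar>t\<bar>" if "\<bar>x\<bar> \<le> 1" for x
    using that by (simp add: abs_mult mult_left_le)
  have "M_inf t \<le> (\<integral>x. exp \<bar>t\<bar> \<partial>mu_inf)"
    unfolding M_inf_def
    by (intro integral_mono_AE) (use AE_mu_inf in \<open>auto elim!: eventually_mono dest!: *\<close>)
  moreover have "(\<integral>x. exp (- \<bar>t\<bar>) \<partial>mu_inf) \<le> M_inf t"
    unfolding M_inf_def
    by (intro integral_mono_AE) (use AE_mu_inf in \<open>auto elim!: eventually_mono dest!: *\<close>)
  ultimately have "exp (- \<bar>t\<bar>) \<le> M_inf t" "M_inf t \<le> exp \<bar>t\<bar>"
    by simp_all
  then have "- \<bar>t\<bar> \<le> ln (M_inf t)" "ln (M_inf t) \<le> \<bar>t\<bar>"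
    using M_inf_pos[of t] by (simp_all add: ln_ge_iff) (metis ln_exp ln_le_cancel_iff exp_gt_zero)
  then show ?thesis by linarith
qed

lemma M_inf_zero: "M_inf 0 = 1"
  by (simp add: M_inf_def)

text \<open>The derivative of \<open>M_inf\<close>, written as an integral so that nothing has to be
  differentiated.\<close>

definition M_inf' :: "real \<Rightarrow> real" where
  "M_inf' t = (\<integral>x. x * exp (t * x) \<partial>mu_inf)"

lemma borel_measurable_M_inf [measurable]: "M_inf \<in> borel_measurable borel"
  unfolding M_inf_def by measurable

lemma borel_measurable_M_inf' [measurable]: "M_inf' \<in> borel_measurable borel"
  unfolding M_inf'_def by measurable

text \<open>Convexity of \<open>ln M_inf\<close> as a supporting line, by Jensen under the law
  tilted by \<open>exp (s * x)\<close>.\<close>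

lemma ln_M_inf_tangent:
  "ln (M_inf s) + (t - s) * (M_inf' s / M_inf s) \<le> ln (M_inf t)"
proof -
  \<comment> \<open>The tilted mean of \<open>(t - s) * x\<close>; centring there makes the linear
    term of \<open>1 + y \<le> exp y\<close> integrate to zero.\<close>
  define m where "m = (t - s) * (M_inf' s / M_inf s)"
  have "exp m * exp (s * x) * (1 + (t - s) * x - m) \<le> exp (t * x)" for x
  proof -
    have "exp m * exp (s * x) * (1 + ((t - s) * x - m)) \<le> exp m * exp (s * x) * exp ((t - s) * x - m)"
      by (intro mult_left_mono exp_ge_add_one_self) auto
    also have "\<dots> = exp (t * x)"
      by (simp add: mult_exp_exp algebra_simps)
    finally show ?thesis by (simp add: algebra_simps)
  qed
  then have "(\<integral>x. (exp m * (1 - m)) * exp (s * x) + (exp m * (t - s)) * (x * exp (s * x)) \<partial>mu_inf) \<le> M_inf t"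
    unfolding M_inf_def
    by (intro integral_mono Bochner_Integration.integrable_add integrable_mult_right integrable_exp_mu_inf integrable_id_exp_mu_inf)
       (simp add: algebra_simps)
  also have "(\<integral>x. (exp m * (1 - m)) * exp (s * x) + (exp m * (t - s)) * (x * exp (s * x)) \<partial>mu_inf)
    = (exp m * (1 - m)) * M_inf s + (exp m * (t - s)) * M_inf' s"
    unfolding M_inf_def M_inf'_def by simp
  also have "\<dots> = exp m * M_inf s"
    using M_inf_pos[of s] by (simp add: m_def field_simps)
  finally have "ln (exp m * M_inf s) \<le> ln (M_inf t)"
    using M_inf_pos by (subst ln_le_cancel_iff) auto
  then show ?thesis
    using M_inf_pos[of s] by (simp add: ln_mult m_def)
qed

section \<open>Solving for the quadratic tilt\<close>

definition tilted_mean_sq :: "real \<Rightarrow> real" where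
  "tilted_mean_sq c = (\<integral>x. x\<^sup>2 * exp (c * x\<^sup>2) \<partial>mu_inf) / (\<integral>x. exp (c * x\<^sup>2) \<partial>mu_inf)"

text \<open>Intermediate values in \<open>c\<close>: the left side vanishes at \<open>0\<close> and
  reaches \<open>v\<close> for large \<open>c\<close>, since the tilt pushes mass towards
  \<open>\<bar>x\<bar> = 1\<close>. As \<open>v > 0\<close>, the factors \<open>c\<close> and
  \<open>q c - v\<close> of a solution are positive.\<close>

lemma exists_tilt:
  fixes v :: real
  assumes v: "0 < v" "v < 1"
  shows "\<exists>c>0. v < tilted_mean_sq c \<and> 2 * c * tilted_mean_sq c * (tilted_mean_sq c - v) = v"
proof -
  define N where "N c = (\<integral>x. exp (c * x\<^sup>2) \<partial>mu_inf)" for c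
  define N2 where "N2 c = (\<integral>x. x\<^sup>2 * exp (c * x\<^sup>2) \<partial>mu_inf)" for c
  define q where "q = tilted_mean_sq"
  have q_eq: "q c = N2 c / N c" for c
    by (simp add: q_def tilted_mean_sq_def N_def N2_def)
  have i1: "integrable mu_inf (\<lambda>x. exp (c * x\<^sup>2))" and i2: "integrable mu_inf (\<lambda>x. x\<^sup>2 * exp (c * x\<^sup>2))"
    for c by (intro integrable_mu_inf_continuous continuous_intros)+
  have N_pos: "0 < N c" for c
    unfolding N_def using i1 by (rule integral_mu_inf_pos[where r = 0]) auto
  have N2_pos: "0 < N2 c" for c
    unfolding N2_def using i2 by (rule integral_mu_inf_pos[where r = 0]) auto
  have q_pos: "0 < q c" for c
    using N_pos N2_pos by (simp add: q_eq)
  have cont: "continuous_on {0..C} N" "continuous_on {0..C} N2" for C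
  proof -
    have *: "continuous_on {0..C} (\<lambda>c. \<integral>x. k x * exp (c * x\<^sup>2) \<partial>mu_inf)"
      if k: "continuous_on UNIV k" and kb: "\<And>x. \<bar>x\<bar> \<le> 1 \<Longrightarrow> \<bar>k x\<bar> \<le> 1" for k :: "real \<Rightarrow> real"
    proof (rule continuous_on_sequentiallyI)
      have [measurable]: "k \<in> borel_measurable borel"
        using k by (rule borel_measurable_continuous_onI)
      fix u :: "nat \<Rightarrow> real" and a
      assume u: "\<forall>n. u n \<in> {0..C}" and lim: "u \<longlonglongrightarrow> a"
      show "(\<lambda>n. \<integral>x. k x * exp (u n * x\<^sup>2) \<partial>mu_inf) \<longlonglongrightarrow> (\<integral>x. k x * exp (a * x\<^sup>2) \<partial>mu_inf)"
      proof (rule integral_dominated_convergence[where w = "\<lambda>_. exp C"])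
        show "AE x in mu_inf. (\<lambda>n. k x * exp (u n * x\<^sup>2)) \<longlonglongrightarrow> k x * exp (a * x\<^sup>2)"
          by (intro AE_I2 tendsto_intros lim)
        show "AE x in mu_inf. norm (k x * exp (u n * x\<^sup>2)) \<le> exp C" for n
          using AE_mu_inf
        proof eventually_elim
          case (elim x)
          have "u n * x\<^sup>2 \<le> C * 1"
            using u elim by (intro mult_mono) (auto simp: abs_square_le_1)
          then have "\<bar>k x\<bar> * exp (u n * x\<^sup>2) \<le> 1 * exp C"
            by (intro mult_mono kb elim) auto
          then show ?case by (simp add: abs_mult)
        qed
      qed auto
    qed
    show "continuous_on {0..C} N" unfolding N_def using *[of "\<lambda>_. 1"] by simp
    show "continuous_on {0..C} N2" unfolding N2_def
      by (rule *) (auto simp: abs_square_le_1 intro!: continuous_intros)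
  qed
  \<comment> \<open>Below \<open>1\<close>, so that \<open>mu_inf\<close> charges
    \<open>x\<^sup>2 > r\<close>; above \<open>v\<close>, so that \<open>q C \<ge> r\<close> keeps
    \<open>q C - v\<close> away from zero.\<close>
  define r where "r = (1 + v) / 2"
  have r: "v < r" "r < 1" "0 < r" using v by (auto simp: r_def)
  define K where "K = (\<integral>x. (max 0 (x\<^sup>2 - r))\<^sup>2 \<partial>mu_inf)"
  have iK: "integrable mu_inf (\<lambda>x. (max 0 (x\<^sup>2 - r))\<^sup>2)"
    by (intro integrable_mu_inf_continuous continuous_intros)
  have K: "0 < K"
    unfolding K_def using iK
  proof (rule integral_mu_inf_pos[where r = "sqrt r"])
    fix x assume "sqrt r < x"
    then have "r < x\<^sup>2" using r by (metis not_less real_le_rsqrt)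
    then show "0 < (max 0 (x\<^sup>2 - r))\<^sup>2" by simp
  qed (use r in auto)
  \<comment> \<open>\<open>1 + 1 / K\<close> yields \<open>C * K \<ge> 1 / C\<close>, hence
    \<open>q C \<ge> r\<close>; the last summand yields
    \<open>2 * C * r * (r - v) \<ge> v\<close>.\<close>
  define C where "C = 1 + 1 / K + v / (2 * r * (r - v))"
  have C1: "1 \<le> C" "1 / K \<le> C" "v / (2 * r * (r - v)) \<le> C"
    using K r v by (auto simp: C_def)
  have qC: "r \<le> q C"
  proof -
    \<comment> \<open>Uniform in \<open>y\<close>: the negative part of \<open>y exp (C y)\<close> is at most \<open>1 / C\<close>, while the positive part grows with \<open>C\<close>.\<close>
    have pw: "- (1 / C) + C * (max 0 y)\<^sup>2 \<le> y * exp (C * y)" for y :: real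
    proof (cases "0 \<le> y")
      case True
      have "y * (1 + C * y) \<le> y * exp (C * y)"
        using True by (intro mult_left_mono exp_ge_add_one_self)
      moreover have "0 \<le> 1 / C" using C1 by simp
      moreover have "y * (1 + C * y) = y + C * (max 0 y)\<^sup>2"
        using True by (simp add: algebra_simps power2_eq_square)
      ultimately show ?thesis using True by linarith
    next
      case False
      have "- (C * y) \<le> exp (- (C * y))"
        using exp_ge_add_one_self[of "- (C * y)"] by linarith
      then have "- (C * y) * exp (C * y) \<le> exp (- (C * y)) * exp (C * y)"
        by (intro mult_right_mono) auto
      also have "\<dots> = 1" by (simp add: mult_exp_exp)
      finally show ?thesis using False C1 by (simp add: field_simps)
    qed
    have "1 \<le> K * C" using C1 K by (simp add: field_simps)
    also have "\<dots> \<le> K * C * C" using C1 K mult_left_mono[of 1 C "K * C"] by simp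
    finally have "0 \<le> - (1 / C) + C * K" using C1 by (simp add: field_simps)
    also have "\<dots> = (\<integral>x. - (1 / C) + C * (max 0 (x\<^sup>2 - r))\<^sup>2 \<partial>mu_inf)"
      using iK by (simp add: K_def)
    \<comment> \<open>This is \<open>pw\<close> at \<open>y = x\<^sup>2 - r\<close>; the integral is
      a positive multiple of \<open>N2 C - r * N C\<close>, whose sign compares \<open>q C\<close>
      with \<open>r\<close>.\<close>
    also have "\<dots> \<le> (\<integral>x. (x\<^sup>2 - r) * exp (C * (x\<^sup>2 - r)) \<partial>mu_inf)"
      by (intro integral_mono pw integrable_mu_inf_continuous continuous_intros)
    also have "\<dots> = (\<integral>x. exp (- C * r) * (x\<^sup>2 * exp (C * x\<^sup>2)) - exp (- C * r) * r * exp (C * x\<^sup>2) \<partial>mu_inf)"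
      by (intro Bochner_Integration.integral_cong) (auto simp: algebra_simps exp_diff exp_minus divide_simps)
    also have "\<dots> = exp (- C * r) * (N2 C - r * N C)"
      using i1 i2 by (simp add: N_def N2_def right_diff_distrib)
    finally have "r * N C \<le> N2 C" by (simp add: zero_le_mult_iff)
    then show ?thesis using N_pos by (simp add: q_eq field_simps)
  qed
  have "v \<le> 2 * C * r * (r - v)"
    using C1(3) r by (simp add: field_simps)
  also have "\<dots> \<le> 2 * C * q C * (q C - v)"
    using qC r C1 by (intro mult_mono) auto
  finally have vC: "v \<le> 2 * C * q C * (q C - v)" .
  have "continuous_on {0..C} q"
    unfolding q_eq using N_pos by (intro continuous_intros cont) (auto simp: less_imp_neq[symmetric])
  then have "continuous_on {0..C} (\<lambda>c. 2 * c * q c * (q c - v))"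
    by (intro continuous_intros)
  then obtain c where c: "0 \<le> c" "2 * c * q c * (q c - v) = v"
    using IVT'[of "\<lambda>c. 2 * c * q c * (q c - v)" 0 v C] vC v C1 by auto
  have c0: "0 < c" using c v by (cases "c = 0") auto
  have "v < q c"
  proof (rule ccontr)
    assume "\<not> v < q c"
    then have "2 * c * q c * (q c - v) \<le> 0" using c0 q_pos[of c] by (intro mult_nonneg_nonpos) auto
    then show False using c v by simp
  qed
  with c c0 show ?thesis
    by (auto simp: q_def)
qed

section \<open>Entropy and the quenched rate function\<close>

lemma prob_space_std_normal: "prob_space std_normal_distribution"
  by (rule prob_space_normal_density) simp

lemma ext_integral_eq:
  assumes "integrable M f"
  shows "ext_integral M f = ereal (\<integral>x. f x \<partial>M)"
proof -
  have "(\<integral>\<^sup>+ x. ennreal (f x) \<partial>M) < \<infinity>" "(\<integral>\<^sup>+ x. ennreal (- f x) \<partial>M) < \<infinity>"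
    using assms by (auto simp: real_integrable_def less_top)
  then show ?thesis
    unfolding ext_integral_def real_lebesgue_integral_def[OF assms]
    by (cases "\<integral>\<^sup>+ x. ennreal (f x) \<partial>M"; cases "\<integral>\<^sup>+ x. ennreal (- f x) \<partial>M")
       (auto simp: enn2ereal_ennreal)
qed

locale admissible_measure =
  fixes \<nu> :: "real measure"
  assumes admissible: "admissible \<nu>"
begin

sublocale real_distribution \<nu>
  using admissible by (simp add: admissible_def)

lemma integrable_sq: "integrable \<nu> (\<lambda>u. u\<^sup>2)"
proof (rule integrableI_nonneg)
  have "(\<integral>\<^sup>+ u. ennreal (u\<^sup>2) \<partial>\<nu>) \<le> 1"
    using admissible by (simp add: admissible_def second_moment_def)
  then show "(\<integral>\<^sup>+ u. ennreal (u\<^sup>2) \<partial>\<nu>) < \<infinity>"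
    by (rule le_less_trans) simp
qed auto

lemma second_moment_eq: "second_moment \<nu> = ennreal (\<integral>u. u\<^sup>2 \<partial>\<nu>)"
  unfolding second_moment_def by (intro nn_integral_eq_integral integrable_sq) auto

lemma integral_sq_le: "(\<integral>u. u\<^sup>2 \<partial>\<nu>) \<le> 1"
  using admissible second_moment_eq by (simp add: admissible_def)

lemma integrable_id: "integrable \<nu> (\<lambda>u. u)"
proof (rule Bochner_Integration.integrable_bound)
  show "integrable \<nu> (\<lambda>u. 1 + u\<^sup>2)"
    using integrable_sq by simp
  have "\<bar>u\<bar> \<le> 1 + u\<^sup>2" for u :: real
    using zero_le_power2[of "\<bar>u\<bar> - 1"] zero_le_power2[of u] by (simp add: power2_diff)
  then show "AE u in \<nu>. norm u \<le> norm (1 + u\<^sup>2)"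
    by (intro AE_I2) (simp add: order_trans[OF _ abs_ge_self])
qed simp

lemma integrable_ln_M_inf: "integrable \<nu> (\<lambda>u. ln (M_inf (s * u)))"
proof (rule Bochner_Integration.integrable_bound)
  show "integrable \<nu> (\<lambda>u. s * u)"
    using integrable_id by simp
  show "AE u in \<nu>. norm (ln (M_inf (s * u))) \<le> norm (s * u)"
    using abs_ln_M_inf_le by simp
qed measurable

lemma Psi_inf_eq: "Psi_inf \<nu> s = ereal (\<integral>u. ln (M_inf (s * u)) \<partial>\<nu>)"
  unfolding Psi_inf_def by (rule ext_integral_eq[OF integrable_ln_M_inf])

lemma I_qu_ge: "ereal (s * w - (\<integral>u. ln (M_inf (s * u)) \<partial>\<nu>)) \<le> I_qu \<nu> w"
  unfolding I_qu_def legendre_def by (rule SUP_upper2[of s]) (simp_all add: Psi_inf_eq)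

lemma I_qu_nonneg: "0 \<le> I_qu \<nu> w"
  using I_qu_ge[of 0 w] by (simp add: M_inf_zero zero_ereal_def)

lemma rate_functional_eq:
  "rate_functional w \<nu> = I_qu \<nu> w + rel_entropy \<nu> std_normal_distribution + ereal ((1 - (\<integral>u. u\<^sup>2 \<partial>\<nu>)) / 2)"
  unfolding rate_functional_def second_moment_eq by (simp add: enn2ereal_ennreal one_ereal_def)

end

text \<open>Since \<open>y ln y\<close> is bounded below, only the positive part of \<open>ln f\<close> can have infinite integral.\<close>
lemma ext_integral_entropy_cases:
  fixes f :: "'a \<Rightarrow> real"
  assumes "prob_space M" and f[measurable]: "f \<in> borel_measurable M" and nn: "\<And>x. 0 \<le> f x"
  shows "integrable (density M f) (\<lambda>x. ln (f x)) \<or> ext_integral (density M f) (\<lambda>x. ln (f x)) = \<infinity>"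
proof -
  interpret prob_space M by fact
  have "(\<integral>\<^sup>+ x. ennreal (- ln (f x)) \<partial>density M f) = (\<integral>\<^sup>+ x. ennreal (f x) * ennreal (- ln (f x)) \<partial>M)"
    by (rule nn_integral_density) auto
  also have "\<dots> \<le> (\<integral>\<^sup>+ x. 1 \<partial>M)"
  proof (intro nn_integral_mono)
    fix x
    have "f x * - ln (f x) \<le> 1"
    proof (cases "f x = 0")
      case False
      then have pos: "0 < f x" using nn[of x] by simp
      then have "ln (inverse (f x)) \<le> inverse (f x) - 1"
        by (intro ln_le_minus_one) simp
      then have "f x * - ln (f x) \<le> f x * (inverse (f x) - 1)"
        using pos by (intro mult_left_mono) (auto simp: ln_inverse)
      also have "\<dots> \<le> 1" using pos by (simp add: algebra_simps)
      finally show ?thesis .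
    qed simp
    then show "ennreal (f x) * ennreal (- ln (f x)) \<le> 1"
      using nn[of x] by (simp flip: ennreal_mult' add: ennreal_le_1)
  qed
  finally have neg: "(\<integral>\<^sup>+ x. ennreal (- ln (f x)) \<partial>density M f) \<le> 1"
    by (simp add: emeasure_space_1)
  show ?thesis
  proof (cases "(\<integral>\<^sup>+ x. ennreal (ln (f x)) \<partial>density M f) = \<infinity>")
    case True
    have "enn2ereal (\<integral>\<^sup>+ x. ennreal (- ln (f x)) \<partial>density M f) \<noteq> \<infinity>"
      using neg by (auto simp: less_eq_ennreal.rep_eq one_ennreal.rep_eq)
    with True show ?thesis
      by (simp add: ext_integral_def)
  next
    case False
    then show ?thesis
      using neg by (auto simp: real_integrable_def top_unique)
  qed
qed

text \<open>\<open>RN_deriv\<close> is determined \<open>M\<close>-almost everywhere; absolute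
  continuity transfers this to \<open>density M f\<close>, under which the logarithm is
  integrated.\<close>

lemma rel_entropy_density:
  fixes f :: "'a \<Rightarrow> real"
  assumes "prob_space M" and f[measurable]: "f \<in> borel_measurable M" and nn: "\<And>x. 0 \<le> f x"
  shows "rel_entropy (density M f) M = ext_integral (density M f) (\<lambda>x. ln (f x))"
proof -
  interpret prob_space M by fact
  have ac: "absolutely_continuous M (density M f)"
    by (rule absolutely_continuousI_density) simp
  have "AE x in M. ennreal (f x) = RN_deriv M (density M f) x"
    by (rule RN_deriv_unique) auto
  then have "AE x in density M f. ennreal (f x) = RN_deriv M (density M f) x"
    by (rule absolutely_continuous_AE[OF _ ac, rotated]) simp
  then have "AE x in density M f. entropy_density (exp 1) M (density M f) x = ln (f x)"
  proof eventually_elim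
    case (elim x)
    then show ?case
      by (simp add: entropy_density_def log_def nn flip: elim)
  qed
  then have "ext_integral (density M f) (entropy_density (exp 1) M (density M f)) = ext_integral (density M f) (\<lambda>x. ln (f x))"
    unfolding ext_integral_def
    by (intro arg_cong2[where f = "(-)"] arg_cong[where f = enn2ereal] nn_integral_cong_AE) auto
  then show ?thesis
    using ac by (simp add: rel_entropy_def)
qed

text \<open>The difference of the integrals is the relative entropy of \<open>density M g\<close>
  with respect to \<open>density M f\<close>. Separate integrals let the terms of
  \<open>ln f\<close> be matched with those of the functional.\<close>

lemma Gibbs_inequality:
  fixes f g :: "'a \<Rightarrow> real"
  assumes M: "prob_space M"
    and f[measurable]: "f \<in> borel_measurable M" and f_pos: "\<And>x. 0 < f x" and pf: "prob_space (density M f)"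
    and g[measurable]: "g \<in> borel_measurable M" and g_nn: "\<And>x. 0 \<le> g x" and pg: "prob_space (density M g)"
    and intf: "integrable (density M g) (\<lambda>x. ln (f x))" and intg: "integrable (density M g) (\<lambda>x. ln (g x))"
  shows "(\<integral>x. ln (f x) \<partial>density M g) \<le> (\<integral>x. ln (g x) \<partial>density M g)"
    and "(\<integral>x. ln (f x) \<partial>density M g) = (\<integral>x. ln (g x) \<partial>density M g) \<Longrightarrow> density M g = density M f"
proof -
  interpret F: information_space "density M f" "exp 1"
    using pf by (simp add: information_space_def information_space_axioms_def)
  let ?D = "\<lambda>x. g x / f x"
  have eq: "density (density M f) ?D = density M g"
    using f_pos by (subst density_density_divide) (auto simp: g_nn less_imp_le less_imp_neq[symmetric] intro!: AE_I2)
  have g_pos: "AE x in density M g. 0 < g x"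
    using g_nn by (subst AE_density) (auto simp: le_less)
  \<comment> \<open>The logarithm is split only where \<open>g\<close> is positive, which is almost
    everywhere under \<open>density M g\<close>.\<close>
  have ln: "AE x in density M g. ln (g x) - ln (f x) = log (exp 1) (?D x)"
    using g_pos by eventually_elim (simp add: log_def ln_divide_pos f_pos)
  have "integrable (density M g) (\<lambda>x. log (exp 1) (?D x))"
    using intg intf ln by (subst integrable_cong_AE[where g = "\<lambda>x. ln (g x) - ln (f x)"]) (auto elim!: eventually_mono)
  then have int: "integrable (density M f) (\<lambda>x. ?D x * log (exp 1) (?D x))"
    unfolding eq[symmetric] using f_pos g_nn
    by (subst (asm) integrable_density) (auto simp: less_imp_le)
  have "KL_divergence (exp 1) (density M f) (density (density M f) ?D) = (\<integral>x. ?D x * log (exp 1) (?D x) \<partial>density M f)"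
    using f_pos g_nn by (intro F.KL_density) (auto simp: less_imp_le)
  also have "\<dots> = (\<integral>x. log (exp 1) (?D x) \<partial>density M g)"
    unfolding eq[symmetric] using f_pos g_nn by (subst integral_density) (auto simp: less_imp_le)
  also have "\<dots> = (\<integral>x. ln (g x) - ln (f x) \<partial>density M g)"
    using ln by (intro integral_cong_AE) auto
  also have "\<dots> = (\<integral>x. ln (g x) \<partial>density M g) - (\<integral>x. ln (f x) \<partial>density M g)"
    using intf intg by simp
  finally have KL: "KL_divergence (exp 1) (density M f) (density (density M f) ?D) = \<dots>" .
  have D: "prob_space (density (density M f) ?D)" "?D \<in> borel_measurable (density M f)" "AE x in density M f. 0 \<le> ?D x"
    using pg f_pos g_nn by (auto simp: eq less_imp_le)
  show "(\<integral>x. ln (f x) \<partial>density M g) \<le> (\<integral>x. ln (g x) \<partial>density M g)"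
    using F.KL_nonneg[OF D int] KL by simp
  show "density M g = density M f" if "(\<integral>x. ln (f x) \<partial>density M g) = (\<integral>x. ln (g x) \<partial>density M g)"
    using F.KL_eq_0_iff_eq[OF D int] KL that eq by simp
qed

text \<open>A slope \<open>s\<close> with the sign of \<open>w\<close> contributes at least
  \<open>\<bar>s\<bar> * (\<bar>w\<bar> - K)\<close> to the supremum, with \<open>K\<close> the
  first absolute moment; this is unbounded once \<open>\<bar>w\<bar> > K\<close>.\<close>

lemma I_qu_std_normal:
  assumes "9 / 10 \<le> \<bar>w\<bar>"
  shows "I_qu std_normal_distribution w = \<infinity>"
proof -
  let ?\<gamma> = "std_normal_distribution"
  have adm: "admissible ?\<gamma>"
    using std_normal_distribution_even_moments[of 1]
    by (auto simp: admissible_def real_dist_normal_dist second_moment_def nn_integral_eq_integral)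
  interpret admissible_measure ?\<gamma> by unfold_locales (rule adm)
  define K where "K = sqrt (2 / pi)"
  have K: "(\<integral>u. \<bar>u\<bar> \<partial>?\<gamma>) = K"
    using std_normal_distribution_odd_moments_abs[of 0] by (simp add: K_def)
  have "2 / pi < (9/10)\<^sup>2"
    using pi_gt3 by (simp add: field_simps power2_eq_square)
  then have Kw: "K < \<bar>w\<bar>"
    using assms real_sqrt_less_mono[of "2 / pi" "(9/10)\<^sup>2"] by (simp add: K_def)
  have "ereal B \<le> I_qu ?\<gamma> w" for B
  proof -
    \<comment> \<open>Scaled so that this lower bound is exactly
      \<open>\<bar>B\<bar>\<close>.\<close>
    define s where "s = sgn w * (\<bar>B\<bar> / (\<bar>w\<bar> - K))"
    have sw: "s * w = \<bar>B\<bar> / (\<bar>w\<bar> - K) * \<bar>w\<bar>"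
      by (simp add: s_def sgn_mult_abs[symmetric] abs_sgn mult.commute mult.left_commute)
    have as: "\<bar>s\<bar> = \<bar>B\<bar> / (\<bar>w\<bar> - K)"
      using Kw assms by (auto simp: s_def abs_mult abs_sgn_eq)
    have "(\<integral>u. ln (M_inf (s * u)) \<partial>?\<gamma>) \<le> (\<integral>u. \<bar>s\<bar> * \<bar>u\<bar> \<partial>?\<gamma>)"
      using integrable_id abs_ln_M_inf_le
      by (intro integral_mono integrable_ln_M_inf) (auto simp: abs_mult[symmetric] intro: order_trans[OF abs_ge_self])
    also have "\<dots> = \<bar>s\<bar> * K"
      using K by simp
    finally have "s * w - \<bar>s\<bar> * K \<le> s * w - (\<integral>u. ln (M_inf (s * u)) \<partial>?\<gamma>)" by simp
    moreover have "s * w - \<bar>s\<bar> * K = \<bar>B\<bar>"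
      unfolding sw as right_diff_distrib[symmetric] using Kw by simp
    ultimately have "B \<le> s * w - (\<integral>u. ln (M_inf (s * u)) \<partial>?\<gamma>)"
      by linarith
    then show ?thesis
      using I_qu_ge[of s w] order_trans ereal_less_eq(3) by blast
  qed
  then show ?thesis
    by (intro ereal_top)
qed

section \<open>Gaussian tilts\<close>

text \<open>Expand in powers of \<open>z - m\<close>, whose normal means are \<open>1\<close>,
  \<open>0\<close> and \<open>\<sigma>\<^sup>2\<close>. Free \<open>a\<close>, \<open>b\<close>,
  \<open>d\<close> let one statement carry the mass and both moments through the later
  integrals.\<close>

lemma normal_density_poly:
  assumes "0 < \<sigma>"
  shows "has_bochner_integral lborel (\<lambda>z. normal_density m \<sigma> z * (a + b * z + d * z\<^sup>2)) (a + b * m + d * (\<sigma>\<^sup>2 + m\<^sup>2))"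
proof -
  have 0: "has_bochner_integral lborel (\<lambda>z. normal_density m \<sigma> z) 1"
    using normal_moment_even[OF assms, of m 0] by simp
  have 1: "has_bochner_integral lborel (\<lambda>z. normal_density m \<sigma> z * (z - m)) 0"
    using normal_moment_odd[OF assms, of m 0] by simp
  have 2: "has_bochner_integral lborel (\<lambda>z. normal_density m \<sigma> z * (z - m)\<^sup>2) (\<sigma>\<^sup>2)"
    using normal_moment_even[OF assms, of m 1] by simp
  have "has_bochner_integral lborel (\<lambda>z. (a + b * m + d * m\<^sup>2) * normal_density m \<sigma> z
      + (b + 2 * d * m) * (normal_density m \<sigma> z * (z - m)) + d * (normal_density m \<sigma> z * (z - m)\<^sup>2))
      ((a + b * m + d * m\<^sup>2) * 1 + (b + 2 * d * m) * 0 + d * \<sigma>\<^sup>2)"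
    by (intro has_bochner_integral_add has_bochner_integral_mult_right 0 1 2)
  then show ?thesis
    by (rule has_bochner_integral_cong[THEN iffD1, rotated 3]) (auto simp: algebra_simps power2_eq_square)
qed

text \<open>Completing the square: up to a constant, the tilted Gaussian is normal with mean
  \<open>m\<close> and variance \<open>\<sigma>\<^sup>2\<close>.\<close>

lemma std_normal_tilt:
  assumes "0 < \<sigma>"
  shows "has_bochner_integral std_normal_distribution
    (\<lambda>z. exp (- ((1 / \<sigma>\<^sup>2 - 1) / 2) * z\<^sup>2 + m / \<sigma>\<^sup>2 * z) * (a + b * z + d * z\<^sup>2))
    (\<sigma> * exp (m\<^sup>2 / (2 * \<sigma>\<^sup>2)) * (a + b * m + d * (\<sigma>\<^sup>2 + m\<^sup>2)))"
proof (rule has_bochner_integral_density)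
  have eq: "std_normal_density z * exp (- ((1 / \<sigma>\<^sup>2 - 1) / 2) * z\<^sup>2 + m / \<sigma>\<^sup>2 * z)
    = \<sigma> * exp (m\<^sup>2 / (2 * \<sigma>\<^sup>2)) * normal_density m \<sigma> z" for z
  proof -
    have "- z\<^sup>2 / 2 + (- ((1 / \<sigma>\<^sup>2 - 1) / 2) * z\<^sup>2 + m / \<sigma>\<^sup>2 * z) = m\<^sup>2 / (2 * \<sigma>\<^sup>2) + - (z - m)\<^sup>2 / (2 * \<sigma>\<^sup>2)"
      using assms by (simp add: field_simps power2_eq_square)
    then have "exp (- z\<^sup>2 / 2) * exp (- ((1 / \<sigma>\<^sup>2 - 1) / 2) * z\<^sup>2 + m / \<sigma>\<^sup>2 * z)
       = exp (m\<^sup>2 / (2 * \<sigma>\<^sup>2)) * exp (- (z - m)\<^sup>2 / (2 * \<sigma>\<^sup>2))"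
      by (simp only: mult_exp_exp)
    then show ?thesis
      using assms by (simp add: normal_density_def real_sqrt_mult field_simps)
  qed
  show "has_bochner_integral lborel (\<lambda>z. std_normal_density z *\<^sub>R
     (exp (- ((1 / \<sigma>\<^sup>2 - 1) / 2) * z\<^sup>2 + m / \<sigma>\<^sup>2 * z) * (a + b * z + d * z\<^sup>2)))
    (\<sigma> * exp (m\<^sup>2 / (2 * \<sigma>\<^sup>2)) * (a + b * m + d * (\<sigma>\<^sup>2 + m\<^sup>2)))"
    using has_bochner_integral_mult_right[OF normal_density_poly[OF assms, of m a b d], of "\<sigma> * exp (m\<^sup>2 / (2 * \<sigma>\<^sup>2))"]
    by (simp only: real_scaleR_def eq mult.assoc[symmetric])
qed auto

text \<open>The right side keeps the positive part only. Needed for lower bounds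
  \<open>1 + y\<close>, which may be negative.\<close>

lemma ennreal_integral_le_nn_integral:
  assumes "integrable M f"
  shows "ennreal (\<integral>x. f x \<partial>M) \<le> (\<integral>\<^sup>+ x. ennreal (f x) \<partial>M)"
proof -
  have "ennreal (\<integral>x. f x \<partial>M) \<le> ennreal (\<integral>x. max 0 (f x) \<partial>M)"
    by (intro ennreal_leI integral_mono assms integrable_max) auto
  also have "\<dots> = (\<integral>\<^sup>+ x. ennreal (max 0 (f x)) \<partial>M)"
    by (intro nn_integral_eq_integral[symmetric] assms integrable_max) auto
  also have "\<dots> = (\<integral>\<^sup>+ x. ennreal (f x) \<partial>M)"
    by (intro nn_integral_cong) (simp add: max_def ennreal_neg)
  finally show ?thesis .
qed

lemma ln_ennreal_ge:
  assumes "ennreal y \<le> x" "0 < y"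
  shows "ereal (ln y) \<le> ln_ennreal x"
proof (cases x)
  case (real r)
  then have "y \<le> r" "0 < r" using assms by (auto simp: ennreal_le_iff)
  then show ?thesis using real assms by (auto simp: ln_ennreal_def)
qed (auto simp: ln_ennreal_def)

text \<open>The tilt \<open>exp (- \<beta> z\<^sup>2 + t z x)\<close> of the product of the standard Gaussian and \<open>mu_inf\<close> is, up to
  normalisation, the law of \<open>(z, x)\<close> with \<open>x\<close> of density \<open>exp (c x\<^sup>2)\<close> with respect to \<open>mu_inf\<close> and, given
  \<open>x\<close>, with \<open>z\<close> normal of mean \<open>\<theta> x\<close> and variance \<open>\<sigma>\<^sup>2\<close>.\<close>
locale gaussian_tilt =
  fixes \<theta> \<sigma> :: real
  assumes \<sigma>: "0 < \<sigma>"
begin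

text \<open>The exponent in \<open>x\<close> left after \<open>z\<close> is integrated out;
  \<open>- \<beta>\<close> and \<open>t\<close> are the coefficients of \<open>z\<^sup>2\<close> and
  \<open>z * x\<close> in the tilt.\<close>

definition c :: real where "c = \<theta>\<^sup>2 / (2 * \<sigma>\<^sup>2)"
definition t :: real where "t = \<theta> / \<sigma>\<^sup>2"
definition \<beta> :: real where "\<beta> = (1 / \<sigma>\<^sup>2 - 1) / 2"
definition N :: real where "N = (\<integral>x. exp (c * x\<^sup>2) \<partial>mu_inf)"
definition N2 :: real where "N2 = (\<integral>x. x\<^sup>2 * exp (c * x\<^sup>2) \<partial>mu_inf)"

definition W :: "real \<Rightarrow> real \<Rightarrow> real" where
  "W z x = exp (- \<beta> * z\<^sup>2 + t * z * x)"

lemma W_measurable [measurable]: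
  "(\<lambda>p. W (f p) (g p)) \<in> borel_measurable M" if [measurable]: "f \<in> borel_measurable M" "g \<in> borel_measurable M"
  unfolding W_def by measurable

lemma N_pos: "0 < N"
  unfolding N_def
  by (rule integral_mu_inf_pos[where r = 0])
     (auto intro!: integrable_mu_inf_continuous continuous_intros)

lemma inner_integral:
  "has_bochner_integral std_normal_distribution (\<lambda>z. W z x * (a + b * z + d * z\<^sup>2))
    (\<sigma> * exp (c * x\<^sup>2) * (a + b * \<theta> * x + d * (\<sigma>\<^sup>2 + \<theta>\<^sup>2 * x\<^sup>2)))"
proof -
  have eq: "W z x = exp (- ((1 / \<sigma>\<^sup>2 - 1) / 2) * z\<^sup>2 + (\<theta> * x) / \<sigma>\<^sup>2 * z)" for z
    by (simp add: W_def t_def \<beta>_def)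
  show ?thesis
    unfolding eq using std_normal_tilt[OF \<sigma>, of "\<theta> * x" a b d]
    by (simp add: c_def power_mult_distrib mult.assoc)
qed

end

text \<open>The two conditions say that \<open>z\<^sup>2\<close> and \<open>z x\<close> have means \<open>1\<close> and \<open>w\<close> under the tilted law.\<close>
locale optimal_tilt = gaussian_tilt +
  fixes w :: real
  assumes moment_z2: "\<sigma>\<^sup>2 * N + \<theta>\<^sup>2 * N2 = N" and moment_zx: "\<theta> * N2 = w * N"
begin

text \<open>This integrates \<open>inner_integral\<close> with \<open>b * x\<close> for
  \<open>b\<close>: the moment conditions turn \<open>z * x\<close> into \<open>w\<close> and
  \<open>z\<^sup>2\<close> into \<open>1\<close>.\<close>

lemma outer_integral:
  "has_bochner_integral mu_inf (\<lambda>x. \<sigma> * exp (c * x\<^sup>2) * (a + b * x * \<theta> * x + d * (\<sigma>\<^sup>2 + \<theta>\<^sup>2 * x\<^sup>2)))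
    (\<sigma> * N * (a + b * w + d))"
proof -
  have 1: "has_bochner_integral mu_inf (\<lambda>x. exp (c * x\<^sup>2)) N"
    unfolding N_def
    by (intro has_bochner_integral_integrable integrable_mu_inf_continuous continuous_intros)
  have 2: "has_bochner_integral mu_inf (\<lambda>x. x\<^sup>2 * exp (c * x\<^sup>2)) N2"
    unfolding N2_def
    by (intro has_bochner_integral_integrable integrable_mu_inf_continuous continuous_intros)
  have "has_bochner_integral mu_inf (\<lambda>x. \<sigma> * (a + d * \<sigma>\<^sup>2) * exp (c * x\<^sup>2) + \<sigma> * (b * \<theta> + d * \<theta>\<^sup>2) * (x\<^sup>2 * exp (c * x\<^sup>2)))
    (\<sigma> * (a + d * \<sigma>\<^sup>2) * N + \<sigma> * (b * \<theta> + d * \<theta>\<^sup>2) * N2)"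
    by (intro has_bochner_integral_add has_bochner_integral_mult_right 1 2)
  also have "\<sigma> * (a + d * \<sigma>\<^sup>2) * N + \<sigma> * (b * \<theta> + d * \<theta>\<^sup>2) * N2
    = \<sigma> * (a * N + b * (\<theta> * N2) + d * (\<sigma>\<^sup>2 * N + \<theta>\<^sup>2 * N2))"
    by (simp add: algebra_simps)
  also have "\<dots> = \<sigma> * N * (a + b * w + d)"
    by (simp only: moment_z2 moment_zx) (simp add: algebra_simps)
  finally show ?thesis
    by (rule has_bochner_integral_cong[THEN iffD1, rotated 3]) (auto simp: algebra_simps power2_eq_square)
qed

sublocale gauss: prob_space std_normal_distribution
  by (rule prob_space_std_normal)

sublocale joint: pair_sigma_finite mu_inf std_normal_distribution ..

text \<open>A multiple of \<open>W z x * (1 + x\<^sup>2 + z\<^sup>2)\<close> dominates; being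
  nonnegative, it equals its norm, so \<open>inner_integral\<close> verifies Fubini's
  criterion.\<close>

lemma joint_integrable:
  "integrable (mu_inf \<Otimes>\<^sub>M std_normal_distribution) (\<lambda>(x, z). W z x * (a + b * x * z + d * z\<^sup>2))"
proof -
  have "integrable (mu_inf \<Otimes>\<^sub>M std_normal_distribution) (\<lambda>(x, z). W z x * (1 + x\<^sup>2 + z\<^sup>2))"
  proof (rule joint.Fubini_integrable)
    have *: "norm (W z x * (1 + x\<^sup>2 + z\<^sup>2)) = W z x * ((1 + x\<^sup>2) + 0 * z + 1 * z\<^sup>2)" for x z
      by (simp add: W_def abs_mult abs_of_nonneg add_nonneg_nonneg)
    show "integrable mu_inf (\<lambda>x. \<integral>z. norm (case (x, z) of (x, z) \<Rightarrow> W z x * (1 + x\<^sup>2 + z\<^sup>2)) \<partial>std_normal_distribution)"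
      unfolding prod.case * has_bochner_integral_integral_eq[OF inner_integral]
      by (intro integrable_mu_inf_continuous continuous_intros)
    show "AE x in mu_inf. integrable std_normal_distribution (\<lambda>z. case (x, z) of (x, z) \<Rightarrow> W z x * (1 + x\<^sup>2 + z\<^sup>2))"
      using inner_integral[of _ "1 + _ ^ 2" 0 1] by (auto simp: has_bochner_integral_iff)
  qed measurable
  then have "integrable (mu_inf \<Otimes>\<^sub>M std_normal_distribution) (\<lambda>p. (\<bar>a\<bar> + \<bar>b\<bar> + \<bar>d\<bar>) * (case p of (x, z) \<Rightarrow> W z x * (1 + x\<^sup>2 + z\<^sup>2)))"
    by (rule integrable_mult_right)
  then show ?thesis
  proof (rule Bochner_Integration.integrable_bound)
    show "AE p in mu_inf \<Otimes>\<^sub>M std_normal_distribution. norm (case p of (x, z) \<Rightarrow> W z x * (a + b * x * z + d * z\<^sup>2))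
      \<le> norm ((\<bar>a\<bar> + \<bar>b\<bar> + \<bar>d\<bar>) * (case p of (x, z) \<Rightarrow> W z x * (1 + x\<^sup>2 + z\<^sup>2)))"
    proof (rule AE_I2, clarify)
      fix x z :: real
      have xz: "\<bar>x * z\<bar> \<le> 1 + x\<^sup>2 + z\<^sup>2"
      proof -
        have "0 \<le> (\<bar>x\<bar> - \<bar>z\<bar>)\<^sup>2" "0 \<le> \<bar>x\<bar> * \<bar>z\<bar>" "(\<bar>x\<bar> - \<bar>z\<bar>)\<^sup>2 = x\<^sup>2 + z\<^sup>2 - 2 * (\<bar>x\<bar> * \<bar>z\<bar>)"
          by (rule zero_le_power2, simp, simp add: power2_diff)
        then show ?thesis unfolding abs_mult by linarith
      qed
      have "\<bar>a + b * x * z + d * z\<^sup>2\<bar> \<le> \<bar>a\<bar> + \<bar>b\<bar> * \<bar>x * z\<bar> + \<bar>d\<bar> * z\<^sup>2"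
        using abs_triangle_ineq[of "a + b * x * z" "d * z\<^sup>2"] abs_triangle_ineq[of a "b * x * z"]
        by (simp add: abs_mult mult.assoc)
      also have "\<dots> \<le> \<bar>a\<bar> * (1 + x\<^sup>2 + z\<^sup>2) + \<bar>b\<bar> * (1 + x\<^sup>2 + z\<^sup>2) + \<bar>d\<bar> * (1 + x\<^sup>2 + z\<^sup>2)"
        using mult_left_mono[of 1 "1 + x\<^sup>2 + z\<^sup>2" "\<bar>a\<bar>"]
        by (intro add_mono mult_left_mono xz) auto
      finally have "\<bar>a + b * x * z + d * z\<^sup>2\<bar> \<le> (\<bar>a\<bar> + \<bar>b\<bar> + \<bar>d\<bar>) * (1 + x\<^sup>2 + z\<^sup>2)"
        by (simp add: algebra_simps)
      then have "W z x * \<bar>a + b * x * z + d * z\<^sup>2\<bar> \<le> W z x * ((\<bar>a\<bar> + \<bar>b\<bar> + \<bar>d\<bar>) * (1 + x\<^sup>2 + z\<^sup>2))"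
        by (intro mult_left_mono) (auto simp: W_def)
      then show "norm (W z x * (a + b * x * z + d * z\<^sup>2)) \<le> norm ((\<bar>a\<bar> + \<bar>b\<bar> + \<bar>d\<bar>) * (W z x * (1 + x\<^sup>2 + z\<^sup>2)))"
        by (simp add: W_def abs_mult mult.left_commute)
    qed
  qed measurable
qed

text \<open>Fubini against \<open>outer_integral\<close>: integrating over \<open>x\<close> first
  leaves \<open>M_inf\<close> and \<open>M_inf'\<close> at \<open>t * z\<close>, which describes the
  \<open>z\<close>-marginal.\<close>

lemma marginal_integral:
  "has_bochner_integral std_normal_distribution
    (\<lambda>z. exp (- \<beta> * z\<^sup>2) * ((a + d * z\<^sup>2) * M_inf (t * z) + b * z * M_inf' (t * z)))
    (\<sigma> * N * (a + b * w + d))"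
proof -
  let ?f = "\<lambda>x z. W z x * (a + b * x * z + d * z\<^sup>2)"
  have eq: "(\<integral>x. ?f x z \<partial>mu_inf) = exp (- \<beta> * z\<^sup>2) * ((a + d * z\<^sup>2) * M_inf (t * z) + b * z * M_inf' (t * z))" for z
  proof -
    have "(\<integral>x. ?f x z \<partial>mu_inf) = (\<integral>x. exp (- \<beta> * z\<^sup>2) * (a + d * z\<^sup>2) * exp (t * z * x)
        + exp (- \<beta> * z\<^sup>2) * b * z * (x * exp (t * z * x)) \<partial>mu_inf)"
      by (intro Bochner_Integration.integral_cong) (auto simp: W_def exp_add exp_diff exp_minus divide_inverse algebra_simps)
    also have "\<dots> = exp (- \<beta> * z\<^sup>2) * (a + d * z\<^sup>2) * M_inf (t * z) + exp (- \<beta> * z\<^sup>2) * b * z * M_inf' (t * z)"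
      unfolding M_inf_def M_inf'_def by simp
    finally show ?thesis by (simp add: algebra_simps)
  qed
  have int: "integrable (mu_inf \<Otimes>\<^sub>M std_normal_distribution) (case_prod ?f)"
    by (rule joint_integrable)
  have "(\<integral>z. (\<integral>x. ?f x z \<partial>mu_inf) \<partial>std_normal_distribution) = (\<integral>x. (\<integral>z. ?f x z \<partial>std_normal_distribution) \<partial>mu_inf)"
    by (rule joint.Fubini_integral[OF int])
  also have "\<dots> = \<sigma> * N * (a + b * w + d)"
    unfolding has_bochner_integral_integral_eq[OF inner_integral]
    by (rule has_bochner_integral_integral_eq[OF outer_integral])
  finally have "(\<integral>z. (\<integral>x. ?f x z \<partial>mu_inf) \<partial>std_normal_distribution) = \<sigma> * N * (a + b * w + d)" .
  moreover have "integrable std_normal_distribution (\<lambda>z. \<integral>x. ?f x z \<partial>mu_inf)"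
    by (rule joint.integrable_snd[OF int])
  ultimately show ?thesis
    unfolding eq by (simp add: has_bochner_integral_iff)
qed

text \<open>Jensen under the tilted law; in logarithms, the supporting plane of
  \<open>Phi_inf\<close> at \<open>(- \<beta>, t)\<close>, valid also where \<open>Phi_inf\<close>
  is infinite.\<close>

lemma Phi_integral_ge:
  "ennreal (\<sigma> * N * exp ((t0 + \<beta>) + (t1 - t) * w))
    \<le> (\<integral>\<^sup>+ x. \<integral>\<^sup>+ z. ennreal (exp (t0 * z\<^sup>2 + t1 * z * x)) \<partial>std_normal_distribution \<partial>mu_inf)"
proof -
  define m where "m = (t0 + \<beta>) + (t1 - t) * w"
  let ?g = "\<lambda>x z. W z x * (exp m * (1 - m) + exp m * (t1 - t) * x * z + exp m * (t0 + \<beta>) * z\<^sup>2)"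
  have pw: "?g x z \<le> exp (t0 * z\<^sup>2 + t1 * z * x)" for x z
  proof -
    \<comment> \<open>The exponent minus that of \<open>W\<close>, centred to have mean zero under
      the tilted law.\<close>
    define y where "y = (t1 - t) * x * z + (t0 + \<beta>) * z\<^sup>2 - m"
    have "?g x z = W z x * exp m * (1 + y)"
      by (simp add: y_def algebra_simps)
    also have "\<dots> \<le> W z x * exp m * exp y"
      by (intro mult_left_mono exp_ge_add_one_self) (auto simp: W_def)
    also have "\<dots> = exp (t0 * z\<^sup>2 + t1 * z * x)"
      by (simp add: W_def y_def mult_exp_exp algebra_simps)
    finally show ?thesis .
  qed
  have "\<sigma> * N * exp m = \<sigma> * N * (exp m * (1 - m) + exp m * (t1 - t) * w + exp m * (t0 + \<beta>))"
    by (simp add: m_def algebra_simps)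
  also have "\<dots> = (\<integral>x. (\<integral>z. ?g x z \<partial>std_normal_distribution) \<partial>mu_inf)"
    unfolding has_bochner_integral_integral_eq[OF inner_integral]
      has_bochner_integral_integral_eq[OF outer_integral] ..
  finally have "ennreal (\<sigma> * N * exp m) = ennreal (\<integral>x. (\<integral>z. ?g x z \<partial>std_normal_distribution) \<partial>mu_inf)"
    by simp
  also have "\<dots> \<le> (\<integral>\<^sup>+ x. ennreal (\<integral>z. ?g x z \<partial>std_normal_distribution) \<partial>mu_inf)"
    unfolding has_bochner_integral_integral_eq[OF inner_integral]
    using outer_integral by (intro ennreal_integral_le_nn_integral) (auto simp: has_bochner_integral_iff)
  also have "\<dots> \<le> (\<integral>\<^sup>+ x. \<integral>\<^sup>+ z. ennreal (?g x z) \<partial>std_normal_distribution \<partial>mu_inf)"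
    using inner_integral by (intro nn_integral_mono ennreal_integral_le_nn_integral) (auto simp: has_bochner_integral_iff)
  also have "\<dots> \<le> (\<integral>\<^sup>+ x. \<integral>\<^sup>+ z. ennreal (exp (t0 * z\<^sup>2 + t1 * z * x)) \<partial>std_normal_distribution \<partial>mu_inf)"
    by (intro nn_integral_mono ennreal_leI pw)
  finally show ?thesis by (simp add: m_def)
qed

text \<open>The supporting plane has slope \<open>(1, w)\<close>, so the Legendre transform is
  bounded above there, and \<open>(1, w)\<close> competes in the infimum.\<close>

lemma I_an_less_top: "I_an w < \<infinity>"
proof -
  have "legendre Phi_inf (1, w) \<le> ereal (- \<beta> + t * w - ln (\<sigma> * N))"
    unfolding legendre_def
  proof (rule SUP_least)
    fix p :: "real \<times> real"
    obtain t0 t1 where p: "p = (t0, t1)" by fastforce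
    have "ereal (ln (\<sigma> * N * exp ((t0 + \<beta>) + (t1 - t) * w))) \<le> Phi_inf p"
      unfolding Phi_inf_def p prod.case using \<sigma> N_pos by (intro ln_ennreal_ge Phi_integral_ge) auto
    also have "ln (\<sigma> * N * exp ((t0 + \<beta>) + (t1 - t) * w)) = ln (\<sigma> * N) + ((t0 + \<beta>) + (t1 - t) * w)"
      using \<sigma> N_pos by (subst ln_mult) auto
    finally have "ereal (p \<bullet> (1, w)) - Phi_inf p
        \<le> ereal (t0 + t1 * w) - ereal (ln (\<sigma> * N) + ((t0 + \<beta>) + (t1 - t) * w))"
      by (intro ereal_minus_mono) (auto simp: p)
    then show "ereal (p \<bullet> (1, w)) - Phi_inf p \<le> ereal (- \<beta> + t * w - ln (\<sigma> * N))"
      by (simp add: algebra_simps)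
  qed
  moreover have "I_an w \<le> legendre Phi_inf (1, w)"
    unfolding I_an_def by (intro Inf_lower) force
  ultimately show ?thesis
    by (metis ereal_infty_less(1) ereal_infty_less_eq(1) order_trans PInfty_neq_ereal(1) less_le ereal_less_eq(1))
qed

end

section \<open>The minimizer\<close>

context optimal_tilt
begin

text \<open>Density of the \<open>z\<close>-marginal of the tilted law relative to the Gaussian;
  \<open>\<sigma> * N\<close> is the mass before normalisation.\<close>

definition h :: "real \<Rightarrow> real" where
  "h z = exp (- \<beta> * z\<^sup>2) * M_inf (t * z) / (\<sigma> * N)"

definition opt :: "real measure" where
  "opt = density std_normal_distribution h"

definition V :: real where
  "V = t * w - \<beta> - ln (\<sigma> * N)"

lemma h_measurable [measurable]: "h \<in> borel_measurable borel"
  unfolding h_def by measurable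

lemma h_pos: "0 < h z"
  using \<sigma> N_pos M_inf_pos by (simp add: h_def)

lemma ln_h: "ln (h z) = - \<beta> * z\<^sup>2 + ln (M_inf (t * z)) - ln (\<sigma> * N)"
  using \<sigma> N_pos M_inf_pos[of "t * z"] by (simp add: h_def ln_mult ln_div)

text \<open>\<open>M_inf' (t * z) / M_inf (t * z)\<close> is the tilted mean of \<open>x\<close>
  given \<open>z\<close>, so \<open>b\<close> multiplies the mixed moment \<open>w\<close>.\<close>

lemma opt_integral:
  "has_bochner_integral opt (\<lambda>z. a + b * (z * (M_inf' (t * z) / M_inf (t * z))) + d * z\<^sup>2) (a + b * w + d)"
  unfolding opt_def
proof (rule has_bochner_integral_density)
  have "has_bochner_integral std_normal_distribution
    (\<lambda>z. 1 / (\<sigma> * N) * (exp (- \<beta> * z\<^sup>2) * ((a + d * z\<^sup>2) * M_inf (t * z) + b * z * M_inf' (t * z))))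
    (1 / (\<sigma> * N) * (\<sigma> * N * (a + b * w + d)))"
    by (intro has_bochner_integral_mult_right marginal_integral)
  also have "1 / (\<sigma> * N) * (\<sigma> * N * (a + b * w + d)) = a + b * w + d"
    using \<sigma> N_pos by simp
  finally show "has_bochner_integral std_normal_distribution
     (\<lambda>z. h z *\<^sub>R (a + b * (z * (M_inf' (t * z) / M_inf (t * z))) + d * z\<^sup>2)) (a + b * w + d)"
    by (rule has_bochner_integral_cong[THEN iffD1, rotated 3])
       (use M_inf_pos \<sigma> N_pos in \<open>auto simp: h_def field_simps less_imp_neq[symmetric]\<close>)
qed (use h_pos in \<open>auto simp: less_imp_le\<close>)

lemma prob_space_opt: "prob_space opt"
proof
  have "emeasure opt (space opt) = (\<integral>\<^sup>+ z. ennreal (h z) \<partial>std_normal_distribution)"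
    by (simp add: opt_def emeasure_density cong: nn_integral_cong)
  also have "\<dots> = ennreal 1"
    using marginal_integral[of 1 0 0] h_pos \<sigma> N_pos
    by (subst nn_integral_eq_integral) (auto simp: h_def[abs_def] has_bochner_integral_iff less_imp_le)
  finally show "emeasure opt (space opt) = 1" by simp
qed

lemma opt_second_moment: "has_bochner_integral opt (\<lambda>z. z\<^sup>2) 1"
  using opt_integral[of 0 0 1] by simp

lemma admissible_opt: "admissible opt"
proof -
  have "second_moment opt = ennreal 1"
    unfolding second_moment_def using opt_second_moment
    by (subst nn_integral_eq_integral) (auto simp: has_bochner_integral_iff)
  then show ?thesis
    using prob_space_opt
    by (auto simp: admissible_def real_distribution_def real_distribution_axioms_def opt_def)
qed

sublocale opt: admissible_measure opt
  by unfold_locales (rule admissible_opt)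

text \<open>The concave objective \<open>s * w - Psi_inf opt s\<close> has slope zero at
  \<open>s = t\<close>; the integrated supporting lines of \<open>ln M_inf\<close> express
  this.\<close>

lemma I_qu_opt_le: "I_qu opt w \<le> ereal (t * w - (\<integral>z. ln (M_inf (t * z)) \<partial>opt))"
  unfolding I_qu_def legendre_def
proof (rule SUP_least)
  fix s :: real
  let ?d = "\<lambda>z. z * (M_inf' (t * z) / M_inf (t * z))"
  have d: "has_bochner_integral opt ?d w"
    using opt_integral[of 0 1 0] by simp
  have "(\<integral>z. ln (M_inf (t * z)) + (s - t) * ?d z \<partial>opt) \<le> (\<integral>z. ln (M_inf (s * z)) \<partial>opt)"
  proof (intro integral_mono opt.integrable_ln_M_inf Bochner_Integration.integrable_add integrable_mult_right)
    show "integrable opt ?d" using d by (simp add: has_bochner_integral_iff)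
    show "ln (M_inf (t * z)) + (s - t) * ?d z \<le> ln (M_inf (s * z))" for z
      using ln_M_inf_tangent[of "t * z" "s * z"] by (simp add: algebra_simps)
  qed
  also have "(\<integral>z. ln (M_inf (t * z)) + (s - t) * ?d z \<partial>opt) = (\<integral>z. ln (M_inf (t * z)) \<partial>opt) + (s - t) * w"
    by (intro has_bochner_integral_integral_eq has_bochner_integral_add has_bochner_integral_mult_right d
        has_bochner_integral_integrable opt.integrable_ln_M_inf)
  finally show "ereal (s \<bullet> w) - Psi_inf opt s \<le> ereal (t * w - (\<integral>z. ln (M_inf (t * z)) \<partial>opt))"
    by (simp add: opt.Psi_inf_eq algebra_simps)
qed


lemma integral_ln_h:
  assumes "admissible_measure \<nu>"
  shows "integrable \<nu> (\<lambda>z. ln (h z))"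
    and "(\<integral>z. ln (h z) \<partial>\<nu>) = - \<beta> * (\<integral>z. z\<^sup>2 \<partial>\<nu>) + (\<integral>z. ln (M_inf (t * z)) \<partial>\<nu>) - ln (\<sigma> * N)"
proof -
  interpret admissible_measure \<nu> by fact
  show "integrable \<nu> (\<lambda>z. ln (h z))"
    unfolding ln_h using integrable_sq integrable_ln_M_inf by auto
  show "(\<integral>z. ln (h z) \<partial>\<nu>) = - \<beta> * (\<integral>z. z\<^sup>2 \<partial>\<nu>) + (\<integral>z. ln (M_inf (t * z)) \<partial>\<nu>) - ln (\<sigma> * N)"
    unfolding ln_h using integrable_sq integrable_ln_M_inf prob_space by simp
qed

text \<open>The second moment \<open>1\<close> removes the last term, and the integrals of
  \<open>ln (M_inf (t * z))\<close> cancel between quenched rate and entropy.\<close>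

lemma rate_functional_opt_le: "rate_functional w opt \<le> ereal V"
proof -
  have "rel_entropy opt std_normal_distribution = ereal (\<integral>z. ln (h z) \<partial>opt)"
    using rel_entropy_density[OF prob_space_std_normal, of h] h_pos integral_ln_h(1)[OF opt.admissible_measure_axioms]
    by (simp add: opt_def[symmetric] less_imp_le ext_integral_eq)
  then have "rate_functional w opt \<le> ereal (t * w - (\<integral>z. ln (M_inf (t * z)) \<partial>opt)) + ereal (\<integral>z. ln (h z) \<partial>opt) + ereal 0"
    unfolding opt.rate_functional_eq using opt_second_moment I_qu_opt_le
    by (intro add_mono) (auto simp: has_bochner_integral_iff)
  also have "\<dots> = ereal V"
    using opt_second_moment
    by (simp add: V_def integral_ln_h(2)[OF opt.admissible_measure_axioms] has_bochner_integral_iff)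
  finally show ?thesis .
qed

text \<open>For finite entropy, slope \<open>t\<close> in the quenched rate makes the excess over
  \<open>V\<close> at least the relative entropy of \<open>\<nu>\<close> with respect to
  \<open>opt\<close> plus \<open>\<beta> + 1 / 2 > 0\<close> times the slack in the moment
  constraint. The equality case of Gibbs gives uniqueness.\<close>

lemma rate_functional_ge:
  assumes "admissible \<nu>"
  shows "ereal V \<le> rate_functional w \<nu>" and "rate_functional w \<nu> \<le> ereal V \<Longrightarrow> \<nu> = opt"
proof -
  interpret admissible_measure \<nu> using assms by unfold_locales
  let ?\<gamma> = "std_normal_distribution"
  have inf: "rate_functional w \<nu> = \<infinity>" if "rel_entropy \<nu> ?\<gamma> = \<infinity>"
    using that I_qu_nonneg[of w] by (auto simp: rate_functional_eq)
  have "ereal V \<le> rate_functional w \<nu> \<and> (rate_functional w \<nu> \<le> ereal V \<longrightarrow> \<nu> = opt)"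
  proof (cases "rel_entropy \<nu> ?\<gamma> = \<infinity>")
    case True
    then show ?thesis using inf by simp
  next
    case False
    then have ac: "absolutely_continuous ?\<gamma> \<nu>"
      by (auto simp: rel_entropy_def split: if_splits)
    define g where "g x = enn2real (RN_deriv ?\<gamma> \<nu> x)" for x
    have g[measurable]: "g \<in> borel_measurable ?\<gamma>" and g_nn: "0 \<le> g x" for x
      unfolding g_def by simp_all
    have "AE x in ?\<gamma>. RN_deriv ?\<gamma> \<nu> x \<noteq> \<infinity>"
      by (rule gauss.RN_deriv_finite) (use ac in \<open>auto intro: sigma_finite_measure_axioms\<close>)
    then have "density ?\<gamma> g = density ?\<gamma> (RN_deriv ?\<gamma> \<nu>)"
      by (intro density_cong) (auto simp: g_def ennreal_enn2real_if elim!: eventually_mono)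
    also have "\<dots> = \<nu>"
      using ac by (intro gauss.density_RN_deriv) auto
    finally have \<nu>: "density ?\<gamma> g = \<nu>" .
    have rel: "rel_entropy \<nu> ?\<gamma> = ext_integral \<nu> (\<lambda>x. ln (g x))"
      using rel_entropy_density[OF prob_space_std_normal g g_nn] by (simp add: \<nu>)
    then have int_g: "integrable \<nu> (\<lambda>x. ln (g x))"
      using ext_integral_entropy_cases[OF prob_space_std_normal g g_nn] False by (simp add: \<nu>)
    let ?L = "\<integral>z. ln (M_inf (t * z)) \<partial>\<nu>" and ?m = "\<integral>z. z\<^sup>2 \<partial>\<nu>"
    let ?R = "(t * w - ?L) + (\<integral>x. ln (g x) \<partial>\<nu>) + (1 - ?m) / 2"
    have R: "ereal ?R \<le> rate_functional w \<nu>"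
      unfolding rate_functional_eq rel ext_integral_eq[OF int_g] plus_ereal.simps(1)[symmetric]
      by (intro add_mono I_qu_ge order_refl)
    have ih: "integrable \<nu> (\<lambda>z. ln (h z))" and
      ihe: "(\<integral>z. ln (h z) \<partial>\<nu>) = - \<beta> * ?m + ?L - ln (\<sigma> * N)"
      using integral_ln_h[OF admissible_measure_axioms] by auto
    have h: "h \<in> borel_measurable ?\<gamma>" by simp
    note Gibbs = Gibbs_inequality[OF prob_space_std_normal h h_pos _ g g_nn, folded opt_def, unfolded \<nu>,
        OF prob_space_opt prob_space_axioms ih int_g]
    have "0 \<le> (1 / (2 * \<sigma>\<^sup>2)) * (1 - ?m)"
      using \<sigma> integral_sq_le by simp
    also have "\<dots> = (\<beta> + 1 / 2) * (1 - ?m)"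
      using \<sigma> by (simp add: \<beta>_def field_simps)
    finally have "(\<integral>x. ln (g x) \<partial>\<nu>) - (\<integral>x. ln (h x) \<partial>\<nu>) \<le> ?R - V"
      unfolding ihe V_def by (simp add: algebra_simps diff_divide_distrib)
    then have RV: "(\<integral>x. ln (g x) \<partial>\<nu>) - (\<integral>x. ln (h x) \<partial>\<nu>) + V \<le> ?R" by simp
    show ?thesis
    proof (intro conjI impI)
      have "V \<le> ?R" using RV Gibbs(1) by linarith
      then show "ereal V \<le> rate_functional w \<nu>"
        using R order_trans ereal_less_eq(3) by blast
      assume "rate_functional w \<nu> \<le> ereal V"
      then have "?R \<le> V" using R order_trans ereal_less_eq(3) by blast
      then show "\<nu> = opt" using RV Gibbs by linarith
    qed
  qed
  then show "ereal V \<le> rate_functional w \<nu>" "rate_functional w \<nu> \<le> ereal V \<Longrightarrow> \<nu> = opt" by auto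
qed

lemma is_minimizer_iff: "is_minimizer w \<nu> \<longleftrightarrow> \<nu> = opt"
proof
  assume *: "is_minimizer w \<nu>"
  then have "\<not> rate_functional w opt < rate_functional w \<nu>" "admissible \<nu>"
    using admissible_opt by (auto simp: is_minimizer_def is_arg_min_def)
  then show "\<nu> = opt"
    using rate_functional_opt_le by (intro rate_functional_ge) auto
next
  assume "\<nu> = opt"
  then show "is_minimizer w \<nu>"
    using admissible_opt rate_functional_opt_le rate_functional_ge(1)
    by (auto simp: is_minimizer_def is_arg_min_def not_less intro: order_trans)
qed

lemma nu_inf_eq: "nu_inf w = opt"
  by (simp add: nu_inf_def is_minimizer_iff)

lemma ex1_minimizer: "\<exists>!\<nu>. is_minimizer w \<nu>"
  by (simp add: is_minimizer_iff)

end

theorem proposition9p2: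
  shows "\<exists>w_star::real. 0 < w_star \<and> w_star < 1 \<and>
    (\<forall>w::real. w_star \<le> \<bar>w\<bar> \<and> \<bar>w\<bar> < 1 \<longrightarrow>
       (\<exists>!\<nu>. is_minimizer w \<nu>) \<and>
       nu_inf w \<noteq> std_normal_distribution \<and>
       I_an w < I_qu std_normal_distribution w)"
proof (rule exI[of _ "9 / 10"], intro conjI allI impI)
  fix w :: real
  assume "9 / 10 \<le> \<bar>w\<bar> \<and> \<bar>w\<bar> < 1"
  then have w: "9 / 10 \<le> \<bar>w\<bar>" "\<bar>w\<bar> < 1" by auto
  have v: "0 < w\<^sup>2" "w\<^sup>2 < 1"
    using w by (auto simp: abs_square_less_1)
  obtain c where c: "0 < c" "w\<^sup>2 < tilted_mean_sq c"
      "2 * c * tilted_mean_sq c * (tilted_mean_sq c - w\<^sup>2) = w\<^sup>2"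
    using exists_tilt[OF v] by blast
  define q where "q = tilted_mean_sq c"
  have q: "w\<^sup>2 < q" "2 * c * q * (q - w\<^sup>2) = w\<^sup>2"
    using c by (simp_all add: q_def)
  \<comment> \<open>With \<open>N2 = q * N\<close> the moment conditions force these values;
    \<open>w\<^sup>2 < q\<close> makes the variance positive.\<close>
  define \<theta> where "\<theta> = w / q"
  define \<sigma> where "\<sigma> = sqrt (1 - w\<^sup>2 / q)"
  have q_pos: "0 < q" using q v by linarith
  have \<sigma>2: "\<sigma>\<^sup>2 = 1 - w\<^sup>2 / q" and \<sigma>: "0 < \<sigma>"
    using q q_pos by (auto simp: \<sigma>_def)
  interpret T: gaussian_tilt \<theta> \<sigma>
    by unfold_locales (rule \<sigma>)
  \<comment> \<open>The exponent determined by \<open>\<theta>\<close> and \<open>\<sigma>\<close>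
    must be the one that produced \<open>q\<close>: this is the equation solved by
    \<open>exists_tilt\<close>.\<close>
  have cc: "T.c = c"
  proof -
    have "T.c = w\<^sup>2 / (2 * q * (q - w\<^sup>2))"
      unfolding T.c_def \<sigma>2 unfolding \<theta>_def using q(1) q_pos by (simp add: field_simps power2_eq_square)
    also have "\<dots> = c"
      using q(1) q_pos by (subst q(2)[symmetric]) (simp add: field_simps)
    finally show ?thesis .
  qed
  have N2: "T.N2 = q * T.N"
    using T.N_pos by (simp add: q_def tilted_mean_sq_def T.N_def T.N2_def cc)
  interpret T: optimal_tilt \<theta> \<sigma> w
  proof
    show "\<theta> * T.N2 = w * T.N"
      unfolding N2 using q_pos by (simp add: \<theta>_def)
    show "\<sigma>\<^sup>2 * T.N + \<theta>\<^sup>2 * T.N2 = T.N"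
      unfolding N2 \<sigma>2 unfolding \<theta>_def using q_pos by (simp add: field_simps power2_eq_square)
  qed
  have I_qu: "I_qu std_normal_distribution w = \<infinity>"
    by (rule I_qu_std_normal[OF w(1)])
  show "\<exists>!\<nu>. is_minimizer w \<nu>"
    by (rule T.ex1_minimizer)
  \<comment> \<open>The minimizer has finite quenched rate at \<open>w\<close>, the Gaussian an
    infinite one.\<close>
  show "nu_inf w \<noteq> std_normal_distribution"
    using T.I_qu_opt_le I_qu by (auto simp: T.nu_inf_eq)
  show "I_an w < I_qu std_normal_distribution w"
    using T.I_an_less_top I_qu by simp
qed simp_all

end
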